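(* Let $f\colon \mathbb{R}^n\to[-\infty,+\infty]$ be a convex function of Legendre type, let $U=\operatorname{int}\operatorname{dom} f$, and let $C$ be a nonempty closed subset of $\mathbb{R}^n$ with $C\subseteq U$. Suppose that $C$ is bounded. Then the left Chebyshev center $\overleftarrow{Z}_{C}$ of $C$ is a singleton, say $\overleftarrow{Z}_{C}=\{y\}$, and $y$ is characterized by $$y\in\operatorname{conv}\overleftarrow{Q}_{C}(y);$$ that is, for every $y\in U$, one has $\overleftarrow{Z}_{C}=\{y\}$ if and only if $y\in\operatorname{conv}\overleftarrow{Q}_{C}(y)$.
   Context: $\mathbb{R}^n$ carries the standard inner product $\langle\cdot,\cdot\rangle$; $\operatorname{conv}$ denotes the convex hull. A convex function of Legendre type (Legendre function) is a proper lower semicontinuous convex function $f$ such that $U=\operatorname{int}\operatorname{dom} f\neq\varnothing$, $f$ is differentiable on $U$ with $\|\nabla f(x_k)\|\to+\infty$ whenever $(x_k)$ is a sequence in $U$ converging to a boundary point of $U$, and $f$ is strictly convex on $U$. The Bregman distance of $f$ is $D(x,y)=f(x)-f(y)-\langle\nabla f(y),x-y\rangle$ if $y\in U$, and $D(x,y)=+\infty$ otherwise. The left Bregman farthest-distance function of $C$ is $\overleftarrow{F}_{C}(y)=\sup_{x\in C}D(x,y)$, and the left Bregman farthest-points map is $\overleftarrow{Q}_{C}(y)=\{x\in C : D(x,y)=\overleftarrow{F}_{C}(y)<+\infty\}$. The left Chebyshev radius is $\overleftarrow{r}_{C}=\inf_{y\in U}\overleftarrow{F}_{C}(y)$, and the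 left Chebyshev center is the set $\overleftarrow{Z}_{C}=\{y\in U : \overleftarrow{F}_{C}(y)=\overleftarrow{r}_{C}<+\infty\}$. *)

theory Defs
  imports "HOL-Analysis.Analysis"
begin

definition edom :: "('a \<Rightarrow> ereal) \<Rightarrow> 'a set" where
  "edom f = {x. f x < \<infinity>}"

definition proper_fun :: "('a \<Rightarrow> ereal) \<Rightarrow> bool" where
  "proper_fun f \<longleftrightarrow> edom f \<noteq> {} \<and> (\<forall>x. f x \<noteq> -\<infinity>)"

definition lsc_fun :: "('a::topological_space \<Rightarrow> ereal) \<Rightarrow> bool" where
  "lsc_fun f \<longleftrightarrow> (\<forall>x. f x \<le> Liminf (at x) f)"

text \<open>Convexity of an extended-real-valued function is convexity of its epigraph, a subset
  of the product with the real line; the library's \<open>convex_on\<close> is for real-valued functions.\<close>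

definition convex_fun :: "('a::real_vector \<Rightarrow> ereal) \<Rightarrow> bool" where
  "convex_fun f \<longleftrightarrow> convex {(x, r::real). f x \<le> ereal r}"

text \<open>The condition is only meaningful where \<open>f\<close> is finite, so \<open>S\<close> is meant to be a convex
  subset of the domain of a proper function \<open>f\<close>.\<close>

definition strictly_convex_fun_on :: "'a::real_vector set \<Rightarrow> ('a \<Rightarrow> ereal) \<Rightarrow> bool" where
  "strictly_convex_fun_on S f \<longleftrightarrow>
     (\<forall>x\<in>S. \<forall>y\<in>S. \<forall>u v :: real. x \<noteq> y \<longrightarrow> 0 < u \<longrightarrow> 0 < v \<longrightarrow> u + v = 1 \<longrightarrow>
        f (u *\<^sub>R x + v *\<^sub>R y) < ereal u * f x + ereal v * f y)"

text \<open>The gradient is used only at interior points of the domain of a proper function, where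
  \<open>real_of_ereal \<circ> f\<close> agrees with \<open>f\<close> on a neighbourhood.\<close>

definition grad :: "('a::real_inner \<Rightarrow> ereal) \<Rightarrow> 'a \<Rightarrow> 'a" where
  "grad f x = (THE g. GDERIV (\<lambda>z. real_of_ereal (f z)) x :> g)"

definition legendre :: "('a::euclidean_space \<Rightarrow> ereal) \<Rightarrow> bool" where
  "legendre f \<longleftrightarrow>
     proper_fun f \<and> lsc_fun f \<and> convex_fun f \<and>
     interior (edom f) \<noteq> {} \<and>
     (\<forall>x \<in> interior (edom f). (\<lambda>z. real_of_ereal (f z)) differentiable (at x)) \<and>
     (\<forall>X b. (\<forall>k::nat. X k \<in> interior (edom f)) \<longrightarrow> b \<in> frontier (interior (edom f)) \<longrightarrow>
        X \<longlonglongrightarrow> b \<longrightarrow> filterlim (\<lambda>k. norm (grad f (X k))) at_top sequentially) \<and>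
     strictly_convex_fun_on (interior (edom f)) f"

definition bregman :: "('a::euclidean_space \<Rightarrow> ereal) \<Rightarrow> 'a \<Rightarrow> 'a \<Rightarrow> ereal" where
  "bregman f x y =
     (if y \<in> interior (edom f) then f x - f y - ereal (grad f y \<bullet> (x - y)) else \<infinity>)"

definition left_farthest_dist :: "('a::euclidean_space \<Rightarrow> ereal) \<Rightarrow> 'a set \<Rightarrow> 'a \<Rightarrow> ereal" where
  "left_farthest_dist f C y = (SUP x\<in>C. bregman f x y)"

definition left_farthest_points :: "('a::euclidean_space \<Rightarrow> ereal) \<Rightarrow> 'a set \<Rightarrow> 'a \<Rightarrow> 'a set" where
  "left_farthest_points f C y =
     {x \<in> C. bregman f x y = left_farthest_dist f C y \<and> left_farthest_dist f C y < \<infinity>}"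

definition left_chebyshev_radius :: "('a::euclidean_space \<Rightarrow> ereal) \<Rightarrow> 'a set \<Rightarrow> ereal" where
  "left_chebyshev_radius f C = (INF y \<in> interior (edom f). left_farthest_dist f C y)"

definition left_chebyshev_center :: "('a::euclidean_space \<Rightarrow> ereal) \<Rightarrow> 'a set \<Rightarrow> 'a set" where
  "left_chebyshev_center f C =
     {y \<in> interior (edom f).
        left_farthest_dist f C y = left_chebyshev_radius f C \<and> left_chebyshev_radius f C < \<infinity>}"

end

theory Submission
  imports Defs
begin

text \<open>Let \<open>p\<close> be \<open>f\<close> as a real function on \<open>U\<close>, and \<open>F\<close> the left farthest-distance function
  of \<open>C\<close>. If weights \<open>u\<close> on points of \<open>C\<close> have barycenter
  \<open>m\<close>, the weighted mean of \<open>D x z\<close> equals \<open>J + D m z\<close>, where \<open>J\<close>, the weighted mean of \<open>p\<close> minus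
  \<open>p m\<close>, does not depend on \<open>z\<close>. Hence if \<open>y\<close> is a convex combination of its own farthest points,
  then \<open>F z \<ge> F y + D y z\<close>, and \<open>y\<close> is the unique minimizer of \<open>F\<close>. Such a point exists: maximize
  \<open>J\<close>, that is \<open>t - p m\<close> over pairs \<open>(m, t)\<close> in the convex hull of the graph of \<open>p\<close> over \<open>C\<close>; the
  first-order condition in the direction of \<open>(x, p x)\<close> says \<open>D x m \<le> J\<close>, and since \<open>J\<close> is the mean of
  \<open>D x m\<close>, all points of positive weight are farthest from \<open>m\<close>.\<close>

text \<open>The inner product is the limit of the difference quotients along \<open>h\<close> from
  the right. It serves twice: for the gradient inequality and for the first-order condition at a
  maximizer.\<close>

lemma GDERIV_inner_le:
  assumes "GDERIV p y :> g" and "\<And>s. 0 < s \<Longrightarrow> s < 1 \<Longrightarrow> p (y + s *\<^sub>R h) - p y \<le> s * c"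
  shows "g \<bullet> h \<le> c"
proof -
  have "(p has_derivative (\<lambda>k. k \<bullet> g)) (at (y + 0 *\<^sub>R h))"
    using assms(1) by (simp add: gderiv_def)
  moreover have "((\<lambda>s. y + s *\<^sub>R h) has_derivative (\<lambda>s. s *\<^sub>R h)) (at (0::real))"
    by (auto intro!: derivative_eq_intros)
  ultimately have "((\<lambda>s. p (y + s *\<^sub>R h)) has_derivative (\<lambda>s. (s *\<^sub>R h) \<bullet> g)) (at 0)"
    using has_derivative_compose by blast
  then have "((\<lambda>s. p (y + s *\<^sub>R h)) has_real_derivative (g \<bullet> h)) (at 0)"
    by (simp add: has_field_derivative_def inner_commute mult.commute[of _ "g \<bullet> h"])
  then have "((\<lambda>s. (p (y + s *\<^sub>R h) - p y) / s) \<longlongrightarrow> g \<bullet> h) (at 0)"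
    by (simp add: DERIV_def)
  then have "((\<lambda>s. (p (y + s *\<^sub>R h) - p y) / s) \<longlongrightarrow> g \<bullet> h) (at_right 0)"
    by (rule filterlim_mono) (auto simp: at_le)
  moreover have "\<forall>\<^sub>F s in at_right 0. (p (y + s *\<^sub>R h) - p y) / s \<le> c"
    unfolding eventually_at_right_field
    using assms(2) by (intro exI[of _ 1]) (auto simp: field_simps)
  ultimately show ?thesis
    by (intro tendsto_upperbound) auto
qed

text \<open>The real-valued core of the argument; \<open>f\<close> enters later through its finite
  values on \<open>U\<close>.\<close>

locale strictly_convex_gradient =
  fixes U :: "'a::euclidean_space set" and p :: "'a \<Rightarrow> real" and g :: "'a \<Rightarrow> 'a"
  assumes convex_U: "convex U"
    and strict: "\<lbrakk>x \<in> U; y \<in> U; x \<noteq> y; 0 < u; 0 < v; u + v = 1\<rbrakk>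
      \<Longrightarrow> p (u *\<^sub>R x + v *\<^sub>R y) < u * p x + v * p y"
    and gderiv: "y \<in> U \<Longrightarrow> GDERIV p y :> g y"
begin

definition D :: "'a \<Rightarrow> 'a \<Rightarrow> real" where
  "D x y = p x - p y - g y \<bullet> (x - y)"

text \<open>Farthest points as attained maxima, so that no supremum has to be formed.\<close>

definition Q :: "'a set \<Rightarrow> 'a \<Rightarrow> 'a set" where
  "Q C y = {x \<in> C. \<forall>x'\<in>C. D x' y \<le> D x y}"

lemma D_self [simp]: "D x x = 0"
  by (simp add: D_def)

lemma D_nonneg:
  assumes "x \<in> U" "y \<in> U"
  shows "0 \<le> D x y"
proof (cases "x = y")
  case False
  have "g y \<bullet> (x - y) \<le> p x - p y"
  proof (rule GDERIV_inner_le[OF gderiv[OF assms(2)]])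
    fix s :: real assume "0 < s" "s < 1"
    then have "p (s *\<^sub>R x + (1 - s) *\<^sub>R y) < s * p x + (1 - s) * p y"
      using assms False by (intro strict) auto
    then show "p (y + s *\<^sub>R (x - y)) - p y \<le> s * (p x - p y)"
      by (simp add: algebra_simps)
  qed
  then show ?thesis
    by (simp add: D_def)
qed simp

text \<open>At the midpoint \<open>?w\<close>, strict convexity gives
  \<open>D ?w y < D x y / 2\<close>, while \<open>D ?w y\<close> is nonnegative.\<close>

lemma D_pos:
  assumes "x \<in> U" "y \<in> U" "x \<noteq> y"
  shows "0 < D x y"
proof -
  let ?w = "(1/2) *\<^sub>R x + (1/2) *\<^sub>R y"
  have "?w \<in> U"
    using convex_U assms by (auto intro: convexD)
  then have "0 \<le> D ?w y"
    using assms D_nonneg by blast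
  moreover have "?w - y = (1/2) *\<^sub>R (x - y)"
    by (simp add: algebra_simps flip: scaleR_add_left)
  moreover have "p ?w < (1/2) * p x + (1/2) * p y"
    using assms by (intro strict) auto
  ultimately show ?thesis
    by (simp add: D_def)
qed

text \<open>For fixed \<open>z\<close>, the difference \<open>D x z - p x\<close> is affine in
  \<open>x\<close>, so its weighted mean is its value at \<open>m\<close>.\<close>

lemma sum_D:
  assumes "sum u S = 1" "(\<Sum>x\<in>S. u x *\<^sub>R x) = m"
  shows "(\<Sum>x\<in>S. u x * D x z) = (\<Sum>x\<in>S. u x * p x) - p m + D m z"
proof -
  have "(\<Sum>x\<in>S. u x * D x z)
    = (\<Sum>x\<in>S. u x * p x + g z \<bullet> (- (u x *\<^sub>R x)) + u x * (g z \<bullet> z - p z))"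
    by (rule sum.cong) (auto simp: D_def algebra_simps)
  also have "\<dots> = (\<Sum>x\<in>S. u x * p x) - g z \<bullet> m + (g z \<bullet> z - p z)"
    unfolding sum.distrib inner_sum_right[symmetric] sum_distrib_right[symmetric] sum_negf
    using assms by simp
  finally show ?thesis
    by (simp add: D_def algebra_simps)
qed

text \<open>Otherwise averaging with the weights of \<open>y\<close> gives J + \<open>D y z\<close>
  \<le> \<open>D q y\<close> \<le> J, against \<open>D_pos\<close>.\<close>

lemma farthest_hull_less:
  assumes "y \<in> U" "y \<in> convex hull Q C y" "z \<in> U" "z \<noteq> y" "q \<in> C"
  shows "\<exists>x\<in>C. D q y < D x z"
proof (rule ccontr)
  assume "\<not> ?thesis"
  then have le: "D x z \<le> D q y" if "x \<in> C" for x
    using that by force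
  obtain S u where S: "finite S" "S \<subseteq> Q C y" "\<forall>x\<in>S. 0 \<le> u x" "sum u S = 1"
    "(\<Sum>x\<in>S. u x *\<^sub>R x) = y"
    using assms(2) unfolding convex_hull_explicit by blast
  have "(\<Sum>x\<in>S. u x * D x z) \<le> (\<Sum>x\<in>S. u x * D q y)"
    using S le by (intro sum_mono mult_left_mono) (auto simp: Q_def)
  also have "\<dots> \<le> (\<Sum>x\<in>S. u x * D x y)"
    using S \<open>q \<in> C\<close> by (intro sum_mono mult_left_mono) (auto simp: Q_def)
  finally have "D y z \<le> 0"
    using sum_D[OF S(4,5), of z] sum_D[OF S(4,5), of y] by simp
  with D_pos[of y z] assms show False
    by auto
qed

lemma ex_farthest_hull:
  assumes "compact C" "C \<noteq> {}" "C \<subseteq> U"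
  shows "\<exists>m\<in>U. m \<in> convex hull Q C m"
proof -
  have cont: "continuous_on U p"
    using gderiv by (auto intro!: continuous_at_imp_continuous_on
        has_derivative_continuous simp: gderiv_def)
  let ?gr = "\<lambda>x. (x, p x)"
  \<comment> \<open>Lifting to the graph turns the weighted mean of \<open>p\<close> into a
    coordinate, so J becomes a continuous function on a compact convex set.\<close>
  let ?K = "convex hull (?gr ` C)"
  have "compact ?K"
    using assms cont
    by (intro compact_convex_hull compact_continuous_image continuous_intros)
      (auto intro: continuous_on_subset)
  have K_U: "fst k \<in> U" if "k \<in> ?K" for k
  proof -
    have "?K \<subseteq> U \<times> UNIV"
      using assms convex_U by (intro hull_minimal convex_Times) auto
    with that show ?thesis
      by auto
  qed
  have "continuous_on ?K (\<lambda>k. snd k - p (fst k))"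
    using K_U by (intro continuous_intros continuous_on_compose2[OF cont]) auto
  moreover have "?K \<noteq> {}"
    using assms(2) by simp
  ultimately obtain k where k: "k \<in> ?K" "\<And>l. l \<in> ?K \<Longrightarrow> snd l - p (fst l) \<le> snd k - p (fst k)"
    using continuous_attains_sup[OF \<open>compact ?K\<close>] by blast
  obtain m t where mt: "k = (m, t)"
    by fastforce
  have "m \<in> U"
    using K_U[OF k(1)] mt by simp
  have D_le: "D x m \<le> t - p m" if "x \<in> C" for x
  proof -
    \<comment> \<open>Maximality of \<open>k\<close> is tested along the segment from
      \<open>k\<close> to \<open>(x, p x)\<close>, and the resulting bound is differentiated at
      \<open>s = 0\<close>.\<close>
    have "(- g m) \<bullet> (x - m) \<le> t - p x"
    proof (rule GDERIV_inner_le[OF GDERIV_minus[OF gderiv[OF \<open>m \<in> U\<close>]]])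
      fix s :: real assume s: "0 < s" "s < 1"
      have "(1 - s) *\<^sub>R k + s *\<^sub>R (x, p x) \<in> ?K"
        using s k(1) \<open>x \<in> C\<close> by (intro convexD) (auto intro: hull_inc)
      from k(2)[OF this] show "- p (m + s *\<^sub>R (x - m)) - - p m \<le> s * (t - p x)"
        by (simp add: mt algebra_simps)
    qed
    then show ?thesis
      by (simp add: D_def)
  qed
  obtain T v where T: "finite T" "T \<subseteq> ?gr ` C" "\<forall>l\<in>T. 0 \<le> v l" "sum v T = 1"
    "(\<Sum>l\<in>T. v l *\<^sub>R l) = (m, t)"
    using k(1) unfolding mt convex_hull_explicit by blast
  \<comment> \<open>Points of the graph are determined by their first coordinate, so the weights on
    \<open>T\<close> move to points of \<open>C\<close>.\<close>
  define S where "S = fst ` T"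
  define u where "u x = v (?gr x)" for x
  have T_S: "T = ?gr ` S"
    using T(2) by (force simp: S_def)
  have inj: "inj_on ?gr S"
    by (auto simp: inj_on_def)
  have "finite S"
    using T(1) by (simp add: S_def)
  moreover have "S \<subseteq> C" "\<forall>x\<in>S. 0 \<le> u x" "sum u S = 1"
    using T(2-4) by (auto simp: T_S u_def sum.reindex[OF inj] o_def)
  ultimately have S: "finite S" "S \<subseteq> C" "\<forall>x\<in>S. 0 \<le> u x" "sum u S = 1"
    by blast+
  have pair: "(\<Sum>x\<in>S. (u x *\<^sub>R x, u x * p x)) = (m, t)"
    using T(5) by (simp add: T_S u_def sum.reindex[OF inj] o_def)
  have bary: "(\<Sum>x\<in>S. u x *\<^sub>R x) = m" "(\<Sum>x\<in>S. u x * p x) = t"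
    using arg_cong[OF pair, of fst] arg_cong[OF pair, of snd]
    by (simp_all add: fst_sum snd_sum)
  \<comment> \<open>The mean of \<open>D x m\<close> is \<open>t - p m\<close> because
    \<open>D m m = 0\<close>. The nonnegative slacks therefore sum to zero, and each
    vanishes.\<close>
  have "(\<Sum>x\<in>S. u x * (t - p m - D x m)) = (\<Sum>x\<in>S. u x * (t - p m)) - (\<Sum>x\<in>S. u x * D x m)"
    by (simp add: right_diff_distrib sum_subtractf)
  also have "\<dots> = 0"
    using sum_D[OF S(4) bary(1), of m] S(4) bary(2) by (simp flip: sum_distrib_right)
  finally have zero: "\<forall>x\<in>S. u x * (t - p m - D x m) = 0"
    using S D_le by (subst (asm) sum_nonneg_eq_0_iff) auto
  \<comment> \<open>A point of weight zero may fail to be farthest, so such points are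
    dropped.\<close>
  let ?S = "{x \<in> S. u x \<noteq> 0}"
  have sub: "?S \<subseteq> Q C m"
    using zero S(2) D_le by (auto simp: Q_def)
  have "sum u ?S = 1" "(\<Sum>x\<in>?S. u x *\<^sub>R x) = m"
    using S(1) unfolding S(4)[symmetric] bary(1)[symmetric]
    by (auto intro!: sum.mono_neutral_left)
  then have "m \<in> convex hull Q C m"
    using S sub unfolding convex_hull_explicit by (intro CollectI exI[of _ ?S] exI[of _ u]) auto
  with \<open>m \<in> U\<close> show ?thesis
    by blast
qed

end

text \<open>The domain is the linear projection of the epigraph.\<close>

lemma convex_edom:
  assumes "convex_fun f"
  shows "convex (edom f)"
proof -
  have "edom f = fst ` {(x, r::real). f x \<le> ereal r}"
  proof (intro equalityI subsetI)
    fix x assume "x \<in> edom f"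
    \<comment> \<open>If \<open>f x\<close> is -\<infinity>, the default value 0 of
      \<open>real_of_ereal\<close> is still an upper bound.\<close>
    then have "f x \<le> ereal (real_of_ereal (f x))"
      by (cases "f x") (auto simp: edom_def)
    then show "x \<in> fst ` {(x, r::real). f x \<le> ereal r}"
      by force
  next
    fix x assume "x \<in> fst ` {(x, r::real). f x \<le> ereal r}"
    then obtain r :: real where "f x \<le> ereal r"
      by auto
    also have "\<dots> < \<infinity>"
      by simp
    finally show "x \<in> edom f"
      by (simp add: edom_def)
  qed
  then show ?thesis
    using assms unfolding convex_fun_def
    by (simp add: convex_linear_image linear_fst)
qed

text \<open>The derivative is a linear functional, represented by \<open>adjoint L 1\<close>;
  uniqueness of derivatives then justifies the \<open>THE\<close> in \<open>grad\<close>.\<close>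

lemma GDERIV_grad:
  fixes f :: "'a::euclidean_space \<Rightarrow> ereal"
  assumes "(\<lambda>z. real_of_ereal (f z)) differentiable (at x)"
  shows "GDERIV (\<lambda>z. real_of_ereal (f z)) x :> grad f x"
proof -
  let ?p = "\<lambda>z. real_of_ereal (f z)"
  obtain L where L: "(?p has_derivative L) (at x)"
    using assms by (auto simp: differentiable_def)
  then have "linear L"
    by (rule has_derivative_linear)
  then have "L = (\<lambda>h. h \<bullet> adjoint L 1)"
    using adjoint_works[of L _ 1] by (auto simp: inner_commute)
  with L have G: "GDERIV ?p x :> adjoint L 1"
    by (simp add: gderiv_def)
  show ?thesis
    unfolding grad_def
  proof (rule theI)
    show "GDERIV ?p x :> adjoint L 1"
      by (rule G)
    fix h assume "GDERIV ?p x :> h"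
    then have "(\<lambda>k. k \<bullet> h) = (\<lambda>k. k \<bullet> adjoint L 1)"
      using G has_derivative_unique unfolding gderiv_def by blast
    then show "h = adjoint L 1"
      by (metis vector_eq_ldot)
  qed
qed

theorem theorem5p2:
  fixes f :: "real ^ 'n \<Rightarrow> ereal" and C :: "(real ^ 'n) set"
  assumes "legendre f"
    and "C \<noteq> {}" and "closed C" and "C \<subseteq> interior (edom f)"
    and "bounded C"
  shows "(\<exists>y. left_chebyshev_center f C = {y}) \<and>
    (\<forall>y \<in> interior (edom f).
       left_chebyshev_center f C = {y} \<longleftrightarrow> y \<in> convex hull (left_farthest_points f C y))"
proof -
  define U where "U = interior (edom f)"
  define p where "p z = real_of_ereal (f z)" for z
  have f_p: "f x = ereal (p x)" if "x \<in> U" for x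
  proof -
    have "x \<in> edom f"
      using that interior_subset by (auto simp: U_def)
    then show ?thesis
      using assms(1) by (cases "f x") (auto simp: p_def edom_def legendre_def proper_fun_def)
  qed
  have convex_U: "convex U"
    using assms(1) by (simp add: U_def legendre_def convex_edom convex_interior)
  interpret strictly_convex_gradient U p "grad f"
  proof
    show "convex U"
      by (rule convex_U)
    show "p (u *\<^sub>R x + v *\<^sub>R y) < u * p x + v * p y"
      if "x \<in> U" "y \<in> U" "x \<noteq> y" "0 < u" "0 < v" "u + v = 1" for x y u v
    proof -
      have "u *\<^sub>R x + v *\<^sub>R y \<in> U"
        using that convex_U by (auto intro: convexD)
      moreover have "f (u *\<^sub>R x + v *\<^sub>R y) < ereal u * f x + ereal v * f y"
        using assms(1) that by (auto simp: legendre_def strictly_convex_fun_on_def U_def)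
      ultimately show ?thesis
        using that by (simp add: f_p)
    qed
    show "GDERIV p y :> grad f y" if "y \<in> U" for y
      using assms(1) that GDERIV_grad[of f y] by (simp add: p_def[abs_def] legendre_def U_def)
  qed
  have C_U: "C \<subseteq> U"
    using assms by (simp add: U_def)
  have bregman_D: "bregman f x y = ereal (D x y)" if "x \<in> C" "y \<in> U" for x y
    using that C_U f_p[of x] f_p[of y] by (auto simp: bregman_def D_def U_def)
  have F_Q: "left_farthest_dist f C y = ereal (D q y)" if "y \<in> U" "q \<in> Q C y" for y q
    unfolding left_farthest_dist_def
    using that by (intro SUP_eqI) (auto simp: Q_def bregman_D)
  have F_ge: "ereal (D x y) \<le> left_farthest_dist f C y" if "y \<in> U" "x \<in> C" for x y
    unfolding left_farthest_dist_def using that by (auto intro!: SUP_upper2 simp: bregman_D)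
  have Q_eq: "left_farthest_points f C y = Q C y" if "y \<in> U" for y
  proof (intro equalityI subsetI)
    fix x assume "x \<in> left_farthest_points f C y"
    then show "x \<in> Q C y"
      using F_ge[OF that] bregman_D[OF _ that]
      by (auto simp: left_farthest_points_def Q_def simp flip: ereal_less_eq(3))
  next
    fix x assume "x \<in> Q C y"
    then show "x \<in> left_farthest_points f C y"
      using F_Q[OF that] bregman_D[OF _ that] by (auto simp: left_farthest_points_def Q_def)
  qed
  have center: "left_chebyshev_center f C = {y}" if "y \<in> U" "y \<in> convex hull Q C y" for y
  proof -
    have "Q C y \<noteq> {}"
      using that(2) by auto
    then obtain q where q: "q \<in> Q C y"
      by blast
    have less: "left_farthest_dist f C y < left_farthest_dist f C z" if z: "z \<in> U" "z \<noteq> y" for z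
    proof -
      obtain x where x: "x \<in> C" "D q y < D x z"
        using farthest_hull_less[OF \<open>y \<in> U\<close> \<open>y \<in> convex hull Q C y\<close> z] q
        by (auto simp: Q_def)
      then have "ereal (D q y) < ereal (D x z)"
        by simp
      also have "\<dots> \<le> left_farthest_dist f C z"
        using F_ge x z by blast
      finally show ?thesis
        using F_Q[OF \<open>y \<in> U\<close> q] by simp
    qed
    have "left_chebyshev_radius f C = left_farthest_dist f C y"
      unfolding left_chebyshev_radius_def U_def[symmetric]
      using \<open>y \<in> U\<close> less by (intro INF_eqI) (metis order.refl less_imp_le, blast)
    moreover have "left_farthest_dist f C y < \<infinity>"
      using F_Q[OF \<open>y \<in> U\<close> q] by simp
    ultimately show ?thesis
      using less \<open>y \<in> U\<close>
      by (auto simp: left_chebyshev_center_def simp flip: U_def) (metis less_irrefl)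
  qed
  have "compact C"
    using assms by (simp add: compact_eq_bounded_closed)
  then obtain m where m: "m \<in> U" "m \<in> convex hull Q C m"
    using ex_farthest_hull[OF _ assms(2) C_U] by blast
  \<comment> \<open>If the center is \<open>{y}\<close>, comparing it with the center
    \<open>{m}\<close> forces \<open>y = m\<close>, which lies in the hull of its farthest points;
    the other direction is \<open>center\<close>.\<close>
  show ?thesis
    using center[OF m] m center Q_eq unfolding U_def[symmetric] by (metis singleton_inject)
qed

end
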